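(* Let $(N,g_N)$ be a Riemannian manifold of non-negative sectional curvature. For any $\lambda\in\mathbb{R}$, the metric $g=dr^2+e^{2r}g_N$ on $\mathbb{R}\times N$ admits a density of the form $f=f(r)$ such that $\overline{\sec}_f\ge\lambda$. On the other hand, $g$ admits no density of the form $f=f(r)$ with $\sec_f\ge -1+\varepsilon$ for any $\varepsilon>0$.
   Context: Here $N$ has dimension at least one and $r$ is the coordinate on $\mathbb{R}$. A density is a smooth function $f$ on the manifold; "of the form $f=f(r)$" means that it depends only on $r$. For an orthonormal pair $(U,V)$ of tangent vectors, $$\sec_f^V(U)=\sec(U,V)+\mathrm{Hess}\,f(V,V),\qquad \overline{\sec}_f^V(U)=\sec_f^V(U)+df(V)^2.$$ $\sec_f\ge\lambda$ (resp. $\overline{\sec}_f\ge\lambda$) means $\sec_f^V(U)\ge\lambda$ (resp. $\overline{\sec}_f^V(U)\ge\lambda$) for every orthonormal pair $(U,V)$ at every point. *)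

theory Defs
  imports "HOL-Analysis.Analysis"
begin

text \<open>Smoothness is only used on open sets \<open>S\<close>, where the full derivatives below are the right notion.\<close>

fun Ck_on :: "nat \<Rightarrow> ('a::real_normed_vector \<Rightarrow> 'b::real_normed_vector) \<Rightarrow> 'a set \<Rightarrow> bool" where
  "Ck_on 0 f S \<longleftrightarrow> continuous_on S f"
| "Ck_on (Suc k) f S \<longleftrightarrow>
     (\<forall>x\<in>S. f differentiable (at x)) \<and> (\<forall>v. Ck_on k (\<lambda>x. frechet_derivative f (at x) v) S)"

definition smooth_on :: "'a set \<Rightarrow> ('a::real_normed_vector \<Rightarrow> 'b::real_normed_vector) \<Rightarrow> bool" where
  "smooth_on S f \<longleftrightarrow> (\<forall>k. Ck_on k f S)"

text \<open>
  The underlying space of a manifold is a whole type, Hausdorff and second countable by its sort;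
  the model space is a Euclidean space, so the dimension \<open>DIM('b)\<close> is at least one.
  A chart is a pair \<open>(U, \<phi>)\<close>; the values of \<open>\<phi>\<close> outside \<open>U\<close> are irrelevant.
\<close>

type_synonym ('a, 'b) chart = "'a set \<times> ('a \<Rightarrow> 'b)"

definition chart_inv :: "('a, 'b) chart \<Rightarrow> 'b \<Rightarrow> 'a" where
  "chart_inv c = inv_into (fst c) (snd c)"

definition is_chart :: "('a::topological_space, 'b::euclidean_space) chart \<Rightarrow> bool" where
  "is_chart c \<longleftrightarrow> open (fst c) \<and> open (snd c ` fst c) \<and>
     homeomorphism (fst c) (snd c ` fst c) (snd c) (chart_inv c)"

definition smooth_atlas ::
  "('a::{t2_space,second_countable_topology}, 'b::euclidean_space) chart set \<Rightarrow> bool" where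
  "smooth_atlas A \<longleftrightarrow> (\<forall>c\<in>A. is_chart c) \<and> (\<Union>c\<in>A. fst c) = UNIV \<and>
     (\<forall>c\<in>A. \<forall>d\<in>A. smooth_on (snd c ` (fst c \<inter> fst d)) (snd d \<circ> chart_inv c))"

definition smooth_fun :: "('a, 'b::euclidean_space) chart set \<Rightarrow> ('a \<Rightarrow> real) \<Rightarrow> bool" where
  "smooth_fun A f \<longleftrightarrow> (\<forall>c\<in>A. smooth_on (snd c ` fst c) (f \<circ> chart_inv c))"

text \<open>
  A tangent vector at \<open>p\<close> is a directional derivative, acting on the real functions that are
  differentiable at \<open>p\<close> and extended by \<open>0\<close> to all other functions. In particular
  \<open>df(X) = X f\<close>, and the push-forward of \<open>X\<close> along \<open>\<pi>\<close> is \<open>\<lambda>h. X (h \<circ> \<pi>)\<close>.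
\<close>

type_synonym 'a tangent = "('a \<Rightarrow> real) \<Rightarrow> real"

definition coord_vec :: "('a, 'b::euclidean_space) chart \<Rightarrow> 'a \<Rightarrow> 'b \<Rightarrow> 'a tangent" where
  "coord_vec c p u = (\<lambda>f. if (f \<circ> chart_inv c) differentiable (at (snd c p))
     then frechet_derivative (f \<circ> chart_inv c) (at (snd c p)) u else 0)"

definition tangent_space :: "('a, 'b::euclidean_space) chart set \<Rightarrow> 'a \<Rightarrow> 'a tangent set" where
  "tangent_space A p = {coord_vec c p u | c u. c \<in> A \<and> p \<in> fst c}"

text \<open>The components of a tangent vector are its values on the coordinate functions.\<close>

definition components :: "('a, 'b::euclidean_space) chart \<Rightarrow> 'a tangent \<Rightarrow> 'b" where
  "components c X = (\<Sum>b\<in>Basis. X (\<lambda>q. snd c q \<bullet> b) *\<^sub>R b)"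

type_synonym 'a metric = "'a \<Rightarrow> 'a tangent \<Rightarrow> 'a tangent \<Rightarrow> real"

definition coord_metric ::
  "('a, 'b::euclidean_space) chart \<Rightarrow> 'a metric \<Rightarrow> 'b \<Rightarrow> 'b \<Rightarrow> 'b \<Rightarrow> real" where
  "coord_metric c g x u v =
     g (chart_inv c x) (coord_vec c (chart_inv c x) u) (coord_vec c (chart_inv c x) v)"

text \<open>Only the values of \<open>g p\<close> on the tangent space at \<open>p\<close> matter.\<close>

definition riemannian_metric :: "('a, 'b::euclidean_space) chart set \<Rightarrow> 'a metric \<Rightarrow> bool" where
  "riemannian_metric A g \<longleftrightarrow>
     (\<forall>p. \<forall>X\<in>tangent_space A p. \<forall>Y\<in>tangent_space A p.
        g p X Y = g p Y X \<and>
        (\<forall>Z\<in>tangent_space A p. \<forall>a b.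
           g p (\<lambda>f. a * X f + b * Y f) Z = a * g p X Z + b * g p Y Z) \<and>
        (X \<noteq> (\<lambda>_. 0) \<longrightarrow> g p X X > 0)) \<and>
     (\<forall>c\<in>A. \<forall>u v. smooth_on (snd c ` fst c) (\<lambda>x. coord_metric c g x u v))"

definition riemannian_manifold ::
  "('a::{t2_space,second_countable_topology}, 'b::euclidean_space) chart set \<Rightarrow> 'a metric \<Rightarrow> bool"
  where "riemannian_manifold A g \<longleftrightarrow> smooth_atlas A \<and> riemannian_metric A g"

text \<open>
  Here \<open>G x u v\<close> is a metric on an open subset of the Euclidean space \<open>'b\<close>. All formulas are
  the usual ones in terms of Christoffel symbols, written without indices: \<open>christoffel G x u v\<close>
  is the covariant derivative at \<open>x\<close> of the constant field \<open>v\<close> in direction \<open>u\<close>, given by the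
  Koszul formula; \<open>curvature\<close> follows the convention
  \<open>R(u,v)w = \<nabla>\<^sub>u\<nabla>\<^sub>vw - \<nabla>\<^sub>v\<nabla>\<^sub>uw - \<nabla>\<^bsub>[u,v]\<^esub>w\<close> for constant fields (so that the bracket vanishes).
\<close>

abbreviation dir_deriv :: "('b::euclidean_space \<Rightarrow> 'c::real_normed_vector) \<Rightarrow> 'b \<Rightarrow> 'b \<Rightarrow> 'c" where
  "dir_deriv F x u \<equiv> frechet_derivative F (at x) u"

definition christoffel ::
  "('b::euclidean_space \<Rightarrow> 'b \<Rightarrow> 'b \<Rightarrow> real) \<Rightarrow> 'b \<Rightarrow> 'b \<Rightarrow> 'b \<Rightarrow> 'b" where
  "christoffel G x u v = (THE w. \<forall>z. 2 * G x w z =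
     dir_deriv (\<lambda>y. G y v z) x u + dir_deriv (\<lambda>y. G y u z) x v - dir_deriv (\<lambda>y. G y u v) x z)"

definition curvature ::
  "('b::euclidean_space \<Rightarrow> 'b \<Rightarrow> 'b \<Rightarrow> real) \<Rightarrow> 'b \<Rightarrow> 'b \<Rightarrow> 'b \<Rightarrow> 'b \<Rightarrow> 'b" where
  "curvature G x u v w =
     dir_deriv (\<lambda>y. christoffel G y v w) x u - dir_deriv (\<lambda>y. christoffel G y u w) x v
     + christoffel G x u (christoffel G x v w) - christoffel G x v (christoffel G x u w)"

definition coord_sec ::
  "('b::euclidean_space \<Rightarrow> 'b \<Rightarrow> 'b \<Rightarrow> real) \<Rightarrow> 'b \<Rightarrow> 'b \<Rightarrow> 'b \<Rightarrow> real" where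
  "coord_sec G x u v = G x (curvature G x u v v) u / (G x u u * G x v v - (G x u v)\<^sup>2)"

definition coord_hess ::
  "('b::euclidean_space \<Rightarrow> 'b \<Rightarrow> 'b \<Rightarrow> real) \<Rightarrow> ('b \<Rightarrow> real) \<Rightarrow> 'b \<Rightarrow> 'b \<Rightarrow> 'b \<Rightarrow> real" where
  "coord_hess G F x u v =
     dir_deriv (\<lambda>y. dir_deriv F y v) x u - dir_deriv F x (christoffel G x u v)"

text \<open>
  Sectional curvature and Hessian of a manifold, at a point \<open>p\<close> of the domain of the chart \<open>c\<close>.
  Both are tensorial, hence do not depend on \<open>c\<close>; conditions on them below are
  imposed in every chart of the atlas around \<open>p\<close>.
\<close>

definition sec :: "('a, 'b::euclidean_space) chart \<Rightarrow> 'a metric \<Rightarrow> 'a \<Rightarrow> 'a tangent \<Rightarrow> 'a tangent \<Rightarrow> real"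
  where "sec c g p X Y =
    coord_sec (coord_metric c g) (snd c p) (components c X) (components c Y)"

definition hess ::
  "('a, 'b::euclidean_space) chart \<Rightarrow> 'a metric \<Rightarrow> ('a \<Rightarrow> real) \<Rightarrow> 'a \<Rightarrow> 'a tangent \<Rightarrow> 'a tangent \<Rightarrow> real"
  where "hess c g f p X Y =
    coord_hess (coord_metric c g) (f \<circ> chart_inv c) (snd c p) (components c X) (components c Y)"

definition lin_indep :: "'a tangent \<Rightarrow> 'a tangent \<Rightarrow> bool" where
  "lin_indep X Y \<longleftrightarrow> (\<forall>a b. (\<lambda>f. a * X f + b * Y f) = (\<lambda>_. 0) \<longrightarrow> a = 0 \<and> b = 0)"

definition nonneg_sec :: "('a, 'b::euclidean_space) chart set \<Rightarrow> 'a metric \<Rightarrow> bool" where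
  "nonneg_sec A g \<longleftrightarrow>
     (\<forall>c\<in>A. \<forall>p\<in>fst c. \<forall>X\<in>tangent_space A p. \<forall>Y\<in>tangent_space A p.
        lin_indep X Y \<longrightarrow> sec c g p X Y \<ge> 0)"

definition orthonormal_pair :: "'a metric \<Rightarrow> 'a \<Rightarrow> 'a tangent \<Rightarrow> 'a tangent \<Rightarrow> bool" where
  "orthonormal_pair g p U V \<longleftrightarrow> g p U U = 1 \<and> g p V V = 1 \<and> g p U V = 0"

text \<open>The argument order \<open>V U\<close> follows the notation \<open>sec\<^sub>f\<^sup>V(U)\<close>.\<close>

definition weighted_sec ::
  "('a, 'b::euclidean_space) chart \<Rightarrow> 'a metric \<Rightarrow> ('a \<Rightarrow> real) \<Rightarrow> 'a \<Rightarrow> 'a tangent \<Rightarrow> 'a tangent \<Rightarrow> real"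
  where "weighted_sec c g f p V U = sec c g p U V + hess c g f p V V"

definition strong_weighted_sec ::
  "('a, 'b::euclidean_space) chart \<Rightarrow> 'a metric \<Rightarrow> ('a \<Rightarrow> real) \<Rightarrow> 'a \<Rightarrow> 'a tangent \<Rightarrow> 'a tangent \<Rightarrow> real"
  where "strong_weighted_sec c g f p V U = weighted_sec c g f p V U + (V f)\<^sup>2"

definition weighted_sec_ge ::
  "('a, 'b::euclidean_space) chart set \<Rightarrow> 'a metric \<Rightarrow> ('a \<Rightarrow> real) \<Rightarrow> real \<Rightarrow> bool" where
  "weighted_sec_ge A g f l \<longleftrightarrow>
     (\<forall>c\<in>A. \<forall>p\<in>fst c. \<forall>U\<in>tangent_space A p. \<forall>V\<in>tangent_space A p.
        orthonormal_pair g p U V \<longrightarrow> weighted_sec c g f p V U \<ge> l)"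

definition strong_weighted_sec_ge ::
  "('a, 'b::euclidean_space) chart set \<Rightarrow> 'a metric \<Rightarrow> ('a \<Rightarrow> real) \<Rightarrow> real \<Rightarrow> bool" where
  "strong_weighted_sec_ge A g f l \<longleftrightarrow>
     (\<forall>c\<in>A. \<forall>p\<in>fst c. \<forall>U\<in>tangent_space A p. \<forall>V\<in>tangent_space A p.
        orthonormal_pair g p U V \<longrightarrow> strong_weighted_sec c g f p V U \<ge> l)"

definition prod_chart :: "('a, 'b) chart \<Rightarrow> ('c, 'd) chart \<Rightarrow> ('a \<times> 'c, 'b \<times> 'd) chart" where
  "prod_chart c d = (fst c \<times> fst d, map_prod (snd c) (snd d))"

definition prod_atlas :: "('a, 'b) chart set \<Rightarrow> ('c, 'd) chart set \<Rightarrow> ('a \<times> 'c, 'b \<times> 'd) chart set" where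
  "prod_atlas A B = {prod_chart c d | c d. c \<in> A \<and> d \<in> B}"

definition line_atlas :: "(real, real) chart set" where
  "line_atlas = {(UNIV, \<lambda>r. r)}"

text \<open>
  \<open>X fst\<close> is \<open>dr(X)\<close>, and \<open>\<lambda>h. X (h \<circ> snd)\<close> is the push-forward of \<open>X\<close> to \<open>N\<close>.
\<close>

definition warped_metric :: "'a metric \<Rightarrow> (real \<times> 'a) metric" where
  "warped_metric gN p X Y = X fst * Y fst
     + exp (2 * fst p) * gN (snd p) (\<lambda>h. X (h \<circ> snd)) (\<lambda>h. Y (h \<circ> snd))"

definition radial_density :: "('a, 'b::euclidean_space) chart set \<Rightarrow> (real \<times> 'a \<Rightarrow> real) \<Rightarrow> bool" where
  "radial_density A f \<longleftrightarrow> smooth_fun (prod_atlas line_atlas A) f \<and> (\<exists>h. \<forall>r q. f (r, q) = h r)"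

end

theory Submission
  imports Defs
begin

text \<open>
  For \<open>g = dr\<^sup>2 + e\<^sup>2\<^sup>r g\<^sub>N\<close> the curvature tensor is that of constant curvature \<open>-1\<close> plus the
  curvature tensor of \<open>g\<^sub>N\<close> scaled by \<open>e\<^sup>2\<^sup>r\<close>; in particular \<open>sec \<ge> -1\<close>, with equality on planes
  containing \<open>\<partial>\<^sub>r\<close>. For \<open>f = f(r)\<close> and a unit vector \<open>V\<close> with \<open>dr(V) = b\<close> one has
  \<open>Hess f(V,V) = f'' b\<^sup>2 + f' (1 - b\<^sup>2)\<close>. Hence \<open>f = k r\<close> with \<open>k \<ge> 1\<close> gives the lower bound
  \<open>-1 + k (1 - b\<^sup>2) + k\<^sup>2 b\<^sup>2 \<ge> k - 1\<close>. Conversely, a bound \<open>sec\<^sub>f \<ge> -1 + \<epsilon>\<close> on the planes containing \<open>\<partial>\<^sub>r\<close>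
  forces both \<open>f'' \<ge> \<epsilon>\<close> (from \<open>V = \<partial>\<^sub>r\<close>) and \<open>f' \<ge> \<epsilon>\<close> (from \<open>V\<close> tangent to \<open>N\<close>), but
  \<open>f'' \<ge> \<epsilon>\<close> makes \<open>f'\<close> negative far to the left.
\<close>

section \<open>Differentiation\<close>

lemma smooth_on_differentiable:
  assumes "smooth_on S f" "x \<in> S"
  shows "f differentiable (at x)"
  using assms unfolding smooth_on_def by (metis Ck_on.simps(2))

lemma smooth_on_dir_deriv:
  fixes f :: "'a::euclidean_space \<Rightarrow> 'b::real_normed_vector"
  assumes "smooth_on S f"
  shows "smooth_on S (\<lambda>x. dir_deriv f x v)"
  using assms unfolding smooth_on_def by (metis Ck_on.simps(2))

text \<open>\<open>frechet_derivative\<close> chooses among all derivatives at \<open>x\<close>.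
  Both functions have the same ones there, so the choices agree even where no derivative
  exists.\<close>

lemma frechet_derivative_transform_open:
  assumes "open S" "x \<in> S" "\<And>y. y \<in> S \<Longrightarrow> f y = g y"
  shows "frechet_derivative f (at x) = frechet_derivative g (at x)"
    and "f differentiable (at x) \<longleftrightarrow> g differentiable (at x)"
proof -
  have "(f has_derivative D) (at x) \<longleftrightarrow> (g has_derivative D) (at x)" for D
    using has_derivative_transform_within_open[OF _ assms(1,2)] assms(3) by metis
  then show "frechet_derivative f (at x) = frechet_derivative g (at x)"
    and "f differentiable (at x) \<longleftrightarrow> g differentiable (at x)"
    by (simp_all add: frechet_derivative_def differentiable_def)
qed

lemma Ck_on_cong_open:
  assumes "open S" "\<And>y. y \<in> S \<Longrightarrow> f y = g y" "Ck_on k f S"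
  shows "Ck_on k g S"
  using assms(2,3)
proof (induction k arbitrary: f g)
  case 0
  then show ?case by (auto cong: continuous_on_cong)
next
  case (Suc k)
  have *: "frechet_derivative f (at x) = frechet_derivative g (at x)"
    "f differentiable (at x) \<longleftrightarrow> g differentiable (at x)" if "x \<in> S" for x
    using frechet_derivative_transform_open[OF assms(1) that] Suc.prems(1) by blast+
  have "Ck_on k (\<lambda>x. frechet_derivative g (at x) v) S" for v
    by (rule Suc.IH[where f = "\<lambda>x. frechet_derivative f (at x) v"])
       (use Suc.prems(2) * in simp_all)
  then show ?case
    using Suc.prems(2) * by simp
qed

lemma smooth_on_cong_open:
  "open S \<Longrightarrow> (\<And>y. y \<in> S \<Longrightarrow> f y = g y) \<Longrightarrow> smooth_on S f \<Longrightarrow> smooth_on S g"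
  unfolding smooth_on_def using Ck_on_cong_open by blast

lemma smooth_on_const: "smooth_on S (\<lambda>x. c)"
proof -
  have "Ck_on k (\<lambda>x. c) S" for k
  proof (induction k arbitrary: c)
    case (Suc k)
    then show ?case by (simp add: frechet_derivative_const)
  qed simp
  then show ?thesis by (simp add: smooth_on_def)
qed

text \<open>A bounded linear map is its own derivative at every point, so its directional
  derivatives are constant functions.\<close>

lemma smooth_on_bounded_linear:
  assumes "bounded_linear f"
  shows "smooth_on S f"
proof -
  have D: "(f has_derivative f) (at x)" for x
    by (rule bounded_linear_imp_has_derivative[OF assms])
  then have *: "f differentiable (at x)" "frechet_derivative f (at x) = f" for x
    by (auto simp: differentiable_def frechet_derivative_at[symmetric])
  have "Ck_on k f S" for k
    using smooth_on_const[of S] bounded_linear.continuous_on[OF assms continuous_on_id]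
    by (cases k) (auto simp: * smooth_on_def)
  then show ?thesis by (simp add: smooth_on_def)
qed

text \<open>Since \<open>f\<close> vanishes at \<open>x\<close>, it is O(|y - x|) there, and a
  factor tending to 0 makes the product o(|y - x|). Only a limit of \<open>e\<close> enters, so this
  applies to a function whose differentiability is still to be shown.\<close>

lemma has_derivative_mult_vanishing:
  fixes f e :: "'a::real_normed_vector \<Rightarrow> real"
  assumes f: "f differentiable (at x)" and "f x = 0"
    and e: "(e \<longlongrightarrow> 0) (at x)"
  shows "((\<lambda>y. e y * f y) has_derivative (\<lambda>_. 0)) (at x)"
proof -
  obtain D where D: "(f has_derivative D) (at x)" using f by (auto simp: differentiable_def)
  obtain K where K: "\<And>h. norm (D h) \<le> norm h * K"
    using has_derivative_bounded_linear[OF D] bounded_linear.bounded by blast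
  have q: "((\<lambda>y. norm (f y - f x - D (y - x)) / norm (y - x)) \<longlongrightarrow> 0) (at x)"
    using D by (simp add: has_derivative_iff_norm)
  \<comment> \<open>The factor beside \<open>\<bar>e y\<bar>\<close> bounds |f y| / |y - x|: the
    remainder quotient tends to 0 and \<open>K\<close> bounds the linear part.\<close>
  have "((\<lambda>y. \<bar>e y\<bar> * (norm (f y - f x - D (y - x)) / norm (y - x) + K)) \<longlongrightarrow> \<bar>0\<bar> * (0 + K)) (at x)"
    by (intro tendsto_intros q e)
  then have t: "((\<lambda>y. \<bar>e y\<bar> * (norm (f y - f x - D (y - x)) / norm (y - x) + K)) \<longlongrightarrow> 0) (at x)"
    by simp
  show ?thesis
  proof (rule has_derivativeI_sandwich[of 1, OF _ _ _ t])
    fix y assume "y \<noteq> x"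
    then have n: "norm (y - x) > 0" by simp
    have "\<bar>f y\<bar> \<le> \<bar>f y - D (y - x)\<bar> + norm (y - x) * K"
      using K[of "y - x"] by (simp add: abs_le_iff) linarith
    then have "\<bar>e y\<bar> * \<bar>f y\<bar> \<le> \<bar>e y\<bar> * (\<bar>f y - D (y - x)\<bar> + norm (y - x) * K)"
      by (rule mult_left_mono) simp
    then show "norm (e y * f y - e x * f x - 0) / norm (y - x)
      \<le> \<bar>e y\<bar> * (norm (f y - f x - D (y - x)) / norm (y - x) + K)"
      using n by (simp add: \<open>f x = 0\<close> abs_mult field_simps)
  qed auto
qed

text \<open>\<open>P\<close> is the Gram operator, with \<open>P w \<bullet> z = g w z\<close>.
  Positivity makes it injective, hence invertible in finite dimension; its inverse \<open>Q\<close>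
  sends the Euclidean gradient of a functional to the vector representing it under
  \<open>g\<close>.\<close>

lemma positive_form_represents:
  fixes g :: "'b::euclidean_space \<Rightarrow> 'b \<Rightarrow> real"
  assumes "bilinear g" "\<And>u. u \<noteq> 0 \<Longrightarrow> g u u > 0"
  obtains Q where "bounded_linear Q" "\<And>w. Q (\<Sum>b\<in>Basis. g w b *\<^sub>R b) = w"
    "\<And>l. linear l \<Longrightarrow> (\<forall>z. g (Q (\<Sum>b\<in>Basis. l b *\<^sub>R b)) z = l z)"
proof -
  define P where "P w = (\<Sum>b\<in>Basis. g w b *\<^sub>R b)" for w
  have lin: "linear (g w)" "linear (\<lambda>w. g w z)" for w z
    using assms(1) by (auto simp: bilinear_def)
  have P: "P w \<bullet> z = g w z" for w z
  proof -
    have "g w z = g w (\<Sum>b\<in>Basis. (z \<bullet> b) *\<^sub>R b)" by (simp add: euclidean_representation)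
    also have "\<dots> = (\<Sum>b\<in>Basis. (z \<bullet> b) * g w b)"
      by (simp add: linear_sum[OF lin(1)] linear_cmul[OF lin(1)])
    also have "\<dots> = P w \<bullet> z"
      by (simp add: P_def inner_sum_left inner_commute[of z] mult.commute)
    finally show ?thesis by simp
  qed
  have "linear P"
    by (rule linearI; rule euclidean_eqI)
       (simp_all add: P inner_left_distrib linear_add[OF lin(2)] linear_cmul[OF lin(2)])
  moreover have "inj P"
    using assms(2) P unfolding linear_injective_0[OF \<open>linear P\<close>]
    by (metis inner_zero_left less_irrefl)
  ultimately obtain Q where Q: "linear Q" "\<And>w. Q (P w) = w" "\<And>w. P (Q w) = w"
    using linear_injective_isomorphism by metis
  show thesis
  proof
    show "bounded_linear Q" using Q(1) by (simp add: linear_linear)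
    show "Q (\<Sum>b\<in>Basis. g w b *\<^sub>R b) = w" for w using Q(2) by (simp add: P_def)
    show "\<forall>z. g (Q (\<Sum>b\<in>Basis. l b *\<^sub>R b)) z = l z" if "linear l" for l :: "'b \<Rightarrow> real"
    proof
      fix z
      have "g (Q (\<Sum>b\<in>Basis. l b *\<^sub>R b)) z = (\<Sum>b\<in>Basis. l b *\<^sub>R b) \<bullet> z"
        by (metis P Q(3))
      also have "\<dots> = l (\<Sum>b\<in>Basis. (z \<bullet> b) *\<^sub>R b)"
        by (simp add: linear_sum[OF that] linear_cmul[OF that] inner_sum_left inner_commute[of z] mult.commute)
      finally show "g (Q (\<Sum>b\<in>Basis. l b *\<^sub>R b)) z = l z"
        by (simp add: euclidean_representation)
    qed
  qed
qed

text \<open>With \<open>e = w - w x\<close> and \<open>Q\<close> the inverse of the Gram operator at \<open>x\<close>, the equation reads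
  \<open>e = Q m - Q ((P\<^sub>y - P\<^sub>x) e)\<close>, where \<open>m\<close> is differentiable and vanishes at \<open>x\<close>. This first gives
  \<open>e \<longlongrightarrow> 0\<close> and then makes the second term of order \<open>o(\<bar>y - x\<bar>)\<close>.\<close>

lemma differentiable_linear_solution:
  fixes g :: "'c::real_normed_vector \<Rightarrow> 'b::euclidean_space \<Rightarrow> 'b \<Rightarrow> real" and w :: "'c \<Rightarrow> 'b"
  assumes S: "open S" "x \<in> S"
    and bil: "\<And>y. y \<in> S \<Longrightarrow> bilinear (g y)"
    and pos: "\<And>u. u \<noteq> 0 \<Longrightarrow> g x u u > 0"
    and sol: "\<And>y z. y \<in> S \<Longrightarrow> g y (w y) z = l y z"
    and dg: "\<And>u v. (\<lambda>y. g y u v) differentiable (at x)"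
    and dl: "\<And>z. (\<lambda>y. l y z) differentiable (at x)"
  shows "w differentiable (at x)"
proof -
  obtain Q where Q: "bounded_linear Q" "\<And>w. Q (\<Sum>b\<in>Basis. g x w b *\<^sub>R b) = w"
    using positive_form_represents[OF bil[OF S(2)] pos] by metis
  define m where "m y = Q (\<Sum>b\<in>Basis. (l y b - g y (w x) b) *\<^sub>R b)" for y
  define e where "e y = w y - w x" for y
  define k where "k y b c = g y c b - g x c b" for y b c
  have lin: "linear (\<lambda>w. g y w z)" if "y \<in> S" for y z
    using bil[OF that] by (auto simp: bilinear_def)
  have expand: "g y u b = (\<Sum>c\<in>Basis. (u \<bullet> c) * g y c b)" if "y \<in> S" for y u b
  proof -
    have "g y u b = g y (\<Sum>c\<in>Basis. (u \<bullet> c) *\<^sub>R c) b" by (simp add: euclidean_representation)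
    then show ?thesis by (simp add: linear_sum[OF lin[OF that]] linear_cmul[OF lin[OF that]])
  qed
  have eq: "e y = m y - (\<Sum>b\<in>Basis. \<Sum>c\<in>Basis. ((e y \<bullet> c) * k y b c) *\<^sub>R Q b)" if "y \<in> S" for y
  proof -
    have "l y b - g y (w x) b = g x (e y) b + (\<Sum>c\<in>Basis. (e y \<bullet> c) * k y b c)" for b
    proof -
      have "l y b - g y (w x) b = g y (e y) b"
        using sol[OF that] by (simp add: e_def linear_diff[OF lin[OF that]])
      then show ?thesis
        by (simp add: expand[OF that, of "e y"] expand[OF S(2), of "e y"] k_def
            algebra_simps sum_subtractf)
    qed
    then have "m y = Q ((\<Sum>b\<in>Basis. g x (e y) b *\<^sub>R b) + (\<Sum>b\<in>Basis. (\<Sum>c\<in>Basis. (e y \<bullet> c) * k y b c) *\<^sub>R b))"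
      by (simp add: m_def scaleR_add_left sum.distrib)
    also have "\<dots> = e y + Q (\<Sum>b\<in>Basis. (\<Sum>c\<in>Basis. (e y \<bullet> c) * k y b c) *\<^sub>R b)"
      by (simp only: linear_add[OF bounded_linear.linear[OF Q(1)]] Q(2))
    also have "Q (\<Sum>b\<in>Basis. (\<Sum>c\<in>Basis. (e y \<bullet> c) * k y b c) *\<^sub>R b)
        = (\<Sum>b\<in>Basis. \<Sum>c\<in>Basis. ((e y \<bullet> c) * k y b c) *\<^sub>R Q b)"
      by (simp add: linear_sum[OF bounded_linear.linear[OF Q(1)]]
        linear_cmul[OF bounded_linear.linear[OF Q(1)]] scaleR_sum_left)
    finally show ?thesis by simp
  qed
  have dm: "m differentiable (at x)"
    unfolding m_def
    by (rule differentiable_compose[OF bounded_linear_imp_differentiable[OF Q(1)]])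
       (auto intro!: differentiable_sum differentiable_scaleR differentiable_diff dg dl)
  have mx: "m x = 0"
    using sol[OF S(2)] bounded_linear.linear[OF Q(1)] by (simp add: m_def linear_0)
  have dk: "(\<lambda>y. k y b c) differentiable (at x)" for b c
    unfolding k_def by (intro differentiable_diff dg) auto
  have kt: "((\<lambda>y. k y b c) \<longlongrightarrow> 0) (at x)" for b c
    using differentiable_imp_continuous_within[OF dk[of b c]]
    by (simp add: continuous_within k_def)
  \<comment> \<open>\<open>K y\<close> bounds the norm of the linear map taking \<open>e\<close> to
    \<open>Q ((P\<^sub>y - P\<^sub>x) e)\<close>.\<close>
  define K where "K y = (\<Sum>b\<in>Basis. \<Sum>c\<in>Basis. \<bar>k y b c\<bar> * norm (Q b))" for y
  have "(K \<longlongrightarrow> 0) (at x)"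
    unfolding K_def
    by (intro tendsto_null_sum tendsto_mult_left_zero tendsto_rabs_zero kt)
  \<comment> \<open>With 1/2 the perturbation is at most half of \<open>norm (e y)\<close> and is
    absorbed on the left, which leaves \<open>norm (e y) \<le> 2 * norm (m y)\<close>.\<close>
  then have Khalf: "eventually (\<lambda>y. K y < 1/2) (at x)"
    by (rule order_tendstoD) simp
  have "eventually (\<lambda>y. y \<in> S) (at x)"
    using S by (simp add: eventually_at_topological) blast
  then have "eventually (\<lambda>y. norm (e y) \<le> 2 * norm (m y)) (at x)"
    using Khalf
  proof eventually_elim
    case (elim y)
    have "norm (e y) \<le> norm (m y) + norm (\<Sum>b\<in>Basis. \<Sum>c\<in>Basis. ((e y \<bullet> c) * k y b c) *\<^sub>R Q b)"
      by (subst eq[OF elim(1)]) (rule norm_triangle_ineq4)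
    also have "norm (\<Sum>b\<in>Basis. \<Sum>c\<in>Basis. ((e y \<bullet> c) * k y b c) *\<^sub>R Q b)
        \<le> (\<Sum>b\<in>Basis. \<Sum>c\<in>Basis. norm (e y) * (\<bar>k y b c\<bar> * norm (Q b)))"
      by (intro order_trans[OF norm_sum] sum_mono)
         (auto simp: abs_mult mult.assoc intro!: mult_right_mono Basis_le_norm)
    also have "\<dots> = norm (e y) * K y"
      by (simp add: K_def sum_distrib_left)
    also have "\<dots> \<le> norm (e y) * (1/2)"
      using elim(2) by (intro mult_left_mono) auto
    finally show ?case by simp
  qed
  moreover have "((\<lambda>y. 2 * norm (m y)) \<longlongrightarrow> 2 * norm (m x)) (at x)"
    using differentiable_imp_continuous_within[OF dm]
    by (intro tendsto_intros) (simp add: continuous_within)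
  ultimately have et: "(e \<longlongrightarrow> 0) (at x)"
    unfolding mx by (intro Lim_null_comparison[of e "\<lambda>y. 2 * norm (m y)"]) simp_all
  have ec: "((\<lambda>y. e y \<bullet> c) \<longlongrightarrow> 0) (at x)" for c
    using tendsto_inner[OF et tendsto_const, of c] by simp
  have "((\<lambda>y. (e y \<bullet> c) * k y b c) has_derivative (\<lambda>_. 0)) (at x)" for b c
    by (rule has_derivative_mult_vanishing[OF dk _ ec]) (simp add: k_def)
  then have "(\<lambda>y. (e y \<bullet> c) * k y b c) differentiable (at x)" for b c
    by (auto simp: differentiable_def)
  then have *: "(\<lambda>y. w x + (m y - (\<Sum>b\<in>Basis. \<Sum>c\<in>Basis. ((e y \<bullet> c) * k y b c) *\<^sub>R Q b)))
      differentiable (at x)"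
    by (auto intro!: differentiable_add differentiable_diff dm differentiable_sum
        differentiable_scaleR)
  have "w y = w x + (m y - (\<Sum>b\<in>Basis. \<Sum>c\<in>Basis. ((e y \<bullet> c) * k y b c) *\<^sub>R Q b))"
    if "y \<in> S" for y
    unfolding eq[OF that, symmetric] by (simp add: e_def)
  from frechet_derivative_transform_open(2)[OF S this] * show ?thesis by simp
qed

section \<open>Levi-Civita connection in coordinates\<close>

text \<open>The metric seen in one chart: later \<open>T\<close> is the image of a chart of
  \<open>N\<close> and \<open>G\<close> its \<open>coord_metric\<close>.\<close>

locale local_metric =
  fixes T :: "'b::euclidean_space set" and G :: "'b \<Rightarrow> 'b \<Rightarrow> 'b \<Rightarrow> real"
  assumes open_T: "open T"
    and bilinear_G: "x \<in> T \<Longrightarrow> bilinear (G x)"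
    and sym_G: "x \<in> T \<Longrightarrow> G x u v = G x v u"
    and pos_G: "x \<in> T \<Longrightarrow> u \<noteq> 0 \<Longrightarrow> G x u u > 0"
    and smooth_G: "smooth_on T (\<lambda>x. G x u v)"
begin

abbreviation \<Gamma> where "\<Gamma> \<equiv> christoffel G"

abbreviation dG where "dG x a u v \<equiv> dir_deriv (\<lambda>y. G y u v) x a"

lemmas G_bilinear_simps =
  bilinear_ladd[OF bilinear_G] bilinear_radd[OF bilinear_G]
  bilinear_lsub[OF bilinear_G] bilinear_rsub[OF bilinear_G]
  bilinear_lmul[OF bilinear_G] bilinear_rmul[OF bilinear_G]
  bilinear_lneg[OF bilinear_G] bilinear_rneg[OF bilinear_G]
  bilinear_lzero[OF bilinear_G] bilinear_rzero[OF bilinear_G]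

lemma diff_G: "x \<in> T \<Longrightarrow> (\<lambda>y. G y u v) differentiable (at x)"
  by (rule smooth_on_differentiable[OF smooth_G])

lemma diff_dG: "x \<in> T \<Longrightarrow> (\<lambda>y. dG y a u v) differentiable (at x)"
  by (rule smooth_on_differentiable[OF smooth_on_dir_deriv[OF smooth_G]])

lemma has_derivative_G: "x \<in> T \<Longrightarrow> ((\<lambda>y. G y u v) has_derivative (\<lambda>a. dG x a u v)) (at x)"
  using diff_G frechet_derivative_works by blast

lemma G_eqI:
  assumes "x \<in> T" "\<And>z. G x w z = G x w' z"
  shows "w = w'"
proof (rule ccontr)
  assume "w \<noteq> w'"
  then have "G x (w - w') (w - w') > 0" using pos_G[OF assms(1)] by simp
  then show False using assms(2)[of "w - w'"] by (simp add: bilinear_lsub[OF bilinear_G[OF assms(1)]])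
qed

lemma dG_sym: "x \<in> T \<Longrightarrow> dG x a u v = dG x a v u"
  by (intro fun_cong[OF frechet_derivative_transform_open(1)[OF open_T]] sym_G)

text \<open>In the slots of \<open>G\<close>, bilinearity is an identity on the open set
  \<open>T\<close> and may be differentiated there.\<close>

lemma linear_dG:
  assumes x: "x \<in> T"
  shows "linear (\<lambda>a. dG x a u v)" "linear (\<lambda>v. dG x a u v)" "linear (\<lambda>u. dG x a u v)"
proof -
  show "linear (\<lambda>a. dG x a u v)" by (rule linear_frechet_derivative[OF diff_G[OF x]])
  have *: "linear (\<lambda>v. dG x a u v)" for u
  proof (rule linearI)
    fix v w and k :: real
    have "((\<lambda>y. G y u v + G y u w) has_derivative (\<lambda>a. dG x a u v + dG x a u w)) (at x)"
      by (intro derivative_intros has_derivative_G x)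
    then have "((\<lambda>y. G y u (v + w)) has_derivative (\<lambda>a. dG x a u v + dG x a u w)) (at x)"
      by (rule has_derivative_transform_within_open[OF _ open_T x]) (simp add: G_bilinear_simps)
    from frechet_derivative_at[OF this, symmetric]
    show "dG x a u (v + w) = dG x a u v + dG x a u w" by (rule fun_cong)
    have "((\<lambda>y. k *\<^sub>R G y u v) has_derivative (\<lambda>a. k *\<^sub>R dG x a u v)) (at x)"
      by (intro derivative_intros has_derivative_G x)
    then have "((\<lambda>y. G y u (k *\<^sub>R v)) has_derivative (\<lambda>a. k *\<^sub>R dG x a u v)) (at x)"
      by (rule has_derivative_transform_within_open[OF _ open_T x]) (simp add: G_bilinear_simps)
    from frechet_derivative_at[OF this, symmetric]
    show "dG x a u (k *\<^sub>R v) = k *\<^sub>R dG x a u v" by (rule fun_cong)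
  qed
  then show "linear (\<lambda>v. dG x a u v)" .
  show "linear (\<lambda>u. dG x a u v)" using *[of v] by (simp add: dG_sym[OF x])
qed

lemma christoffelI:
  assumes x: "x \<in> T" and w: "\<And>z. 2 * G x w z = dG x u v z + dG x v u z - dG x z u v"
  shows "\<Gamma> x u v = w"
  unfolding christoffel_def
proof (rule the_equality)
  fix w' assume "\<forall>z. 2 * G x w' z = dG x u v z + dG x v u z - dG x z u v"
  then have "2 * G x w' z = 2 * G x w z" for z unfolding w by blast
  then show "w' = w" by (intro G_eqI[OF x]) simp
qed (simp add: w)

text \<open>Existence behind the definite description in \<open>christoffel\<close>: the right side
  is linear in \<open>z\<close>, so the positive form \<open>G x\<close> represents it by a vector.
  Uniqueness is in \<open>christoffelI\<close>.\<close>

lemma koszul: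
  assumes x: "x \<in> T"
  shows "2 * G x (\<Gamma> x u v) z = dG x u v z + dG x v u z - dG x z u v"
proof -
  obtain Q where Q: "\<And>l. linear l \<Longrightarrow> (\<forall>z. G x (Q (\<Sum>b\<in>Basis. l b *\<^sub>R b)) z = l z)"
    using positive_form_represents[OF bilinear_G[OF x] pos_G[OF x]] by metis
  have "linear (\<lambda>z. (1/2) *\<^sub>R (dG x u v z + dG x v u z - dG x z u v))"
    by (intro linear_compose_scale_right linear_compose_add linear_compose_sub linear_dG x)
  from Q[OF this] obtain w
    where w: "\<And>z. G x w z = (1/2) *\<^sub>R (dG x u v z + dG x v u z - dG x z u v)" by blast
  have "\<Gamma> x u v = w"
    by (rule christoffelI[OF x]) (simp add: w)
  then show ?thesis by (simp add: w)
qed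

lemma christoffel_sym: "x \<in> T \<Longrightarrow> \<Gamma> x u v = \<Gamma> x v u"
  by (rule christoffelI) (simp_all add: koszul dG_sym[of x v u])

text \<open>Adding the two Koszul formulas with \<open>u\<close> and \<open>v\<close> exchanged
  leaves twice this derivative; the other four terms cancel by symmetry.\<close>

lemma metric_compatible:
  assumes x: "x \<in> T"
  shows "dG x a u v = G x (\<Gamma> x a u) v + G x u (\<Gamma> x a v)"
  using koszul[OF x, of a u v] koszul[OF x, of a v u] sym_G[OF x, of u "\<Gamma> x a v"]
    dG_sym[OF x, of u v a] dG_sym[OF x, of a v u] dG_sym[OF x, of a u v]
  by linarith

lemma linear_christoffel:
  assumes x: "x \<in> T"
  shows "linear (\<Gamma> x u)"
proof (rule linearI)
  fix v w and k :: real
  note lin = linear_dG[OF x, THEN linear_add] linear_dG[OF x, THEN linear_cmul]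
  show "\<Gamma> x u (v + w) = \<Gamma> x u v + \<Gamma> x u w"
    using x by (intro christoffelI) (simp_all add: G_bilinear_simps lin koszul distrib_left)
  show "\<Gamma> x u (k *\<^sub>R v) = k *\<^sub>R \<Gamma> x u v"
  proof (rule christoffelI[OF x])
    fix z
    show "2 * G x (k *\<^sub>R \<Gamma> x u v) z = dG x u (k *\<^sub>R v) z + dG x (k *\<^sub>R v) u z - dG x z u (k *\<^sub>R v)"
      using arg_cong[OF koszul[OF x, of u v z], of "\<lambda>t. k * t"]
      by (simp add: G_bilinear_simps x lin algebra_simps)
  qed
qed

text \<open>In place of an inverse matrix, the Koszul formula is read as a linear equation for
  \<open>\<Gamma> y u v\<close> whose coefficients are differentiable in \<open>y\<close>.\<close>

lemma diff_christoffel: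
  assumes x: "x \<in> T"
  shows "(\<lambda>y. \<Gamma> y u v) differentiable (at x)"
proof (rule differentiable_linear_solution[OF open_T x])
  show "G y (\<Gamma> y u v) z = (1/2) * (dG y u v z + dG y v u z - dG y z u v)" if "y \<in> T" for y z
    using koszul[OF that, of u v z] by simp
  show "(\<lambda>y. (1/2) * (dG y u v z + dG y v u z - dG y z u v)) differentiable (at x)" for z
    by (intro differentiable_mult differentiable_const differentiable_add differentiable_diff
        diff_dG x)
qed (use x diff_G bilinear_G pos_G in auto)

lemma has_derivative_christoffel:
  "x \<in> T \<Longrightarrow> ((\<lambda>y. \<Gamma> y u v) has_derivative (\<lambda>a. dir_deriv (\<lambda>y. \<Gamma> y u v) x a)) (at x)"
  using diff_christoffel frechet_derivative_works by blast

text \<open>Homogeneity of \<open>\<Gamma>\<close> in both slots makes both differences in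
  \<open>curvature\<close> cancel. This treats degenerate planes in \<open>N\<close>;
  \<open>t = 0\<close> covers a vanishing second argument.\<close>

lemma curvature_parallel:
  assumes x: "x \<in> T"
  shows "curvature G x u (t *\<^sub>R u) w = 0"
proof -
  note \<Gamma>2 = linear_cmul[OF linear_christoffel]
  have \<Gamma>1: "\<Gamma> y (t *\<^sub>R u) w = t *\<^sub>R \<Gamma> y u w" if "y \<in> T" for y w
    using \<Gamma>2[OF that, of w t u] by (simp add: christoffel_sym[OF that, of _ w])
  have "((\<lambda>y. t *\<^sub>R \<Gamma> y u w) has_derivative (\<lambda>a. t *\<^sub>R dir_deriv (\<lambda>y. \<Gamma> y u w) x a)) (at x)"
    by (intro derivative_intros has_derivative_christoffel x)
  then have "((\<lambda>y. \<Gamma> y (t *\<^sub>R u) w) has_derivative (\<lambda>a. t *\<^sub>R dir_deriv (\<lambda>y. \<Gamma> y u w) x a)) (at x)"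
    by (rule has_derivative_transform_within_open[OF _ open_T x]) (simp add: \<Gamma>1)
  from fun_cong[OF frechet_derivative_at[OF this, symmetric]]
  have "dir_deriv (\<lambda>y. \<Gamma> y (t *\<^sub>R u) w) x u = t *\<^sub>R dir_deriv (\<lambda>y. \<Gamma> y u w) x u" .
  then show ?thesis
    by (simp add: curvature_def \<Gamma>1 \<Gamma>2 x linear_cmul[OF linear_frechet_derivative[OF diff_christoffel]])
qed

text \<open>Strict Cauchy-Schwarz: the determinant is \<open>G x u u\<close> times the square length
  of \<open>v - s *\<^sub>R u\<close>, the component of \<open>v\<close> orthogonal to
  \<open>u\<close>. It is the denominator in \<open>coord_sec\<close>.\<close>

lemma gram_pos:
  assumes x: "x \<in> T" and uv: "\<And>t. v \<noteq> t *\<^sub>R u" and "u \<noteq> 0"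
  shows "G x u u * G x v v - (G x u v)\<^sup>2 > 0"
proof -
  define s where "s = G x u v / G x u u"
  have uu: "G x u u > 0" using pos_G[OF x \<open>u \<noteq> 0\<close>] .
  have "v - s *\<^sub>R u \<noteq> 0" using uv[of s] by simp
  then have "G x (v - s *\<^sub>R u) (v - s *\<^sub>R u) > 0" by (rule pos_G[OF x])
  then have "G x v v - 2 * s * G x u v + s\<^sup>2 * G x u u > 0"
    by (simp add: G_bilinear_simps x sym_G[OF x, of v u] algebra_simps power2_eq_square)
  with uu have "G x u u * (G x v v - 2 * s * G x u v + s\<^sup>2 * G x u u) > 0"
    by (rule mult_pos_pos)
  also have "G x u u * (G x v v - 2 * s * G x u v + s\<^sup>2 * G x u u) = G x u u * G x v v - (G x u v)\<^sup>2"
    using uu by (simp add: s_def field_simps power2_eq_square)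
  finally show ?thesis .
qed

end

section \<open>Warped products in coordinates\<close>

text \<open>\<open>H\<close> is the warped metric in a product chart. Its connection is computed
  directly from that of \<open>G\<close>, without making \<open>H\<close> an instance of
  \<open>local_metric\<close>.\<close>

locale warped_local_metric = local_metric T G
  for T :: "'b::euclidean_space set" and G +
  fixes H :: "real \<times> 'b \<Rightarrow> real \<times> 'b \<Rightarrow> real \<times> 'b \<Rightarrow> real"
  assumes warped: "x \<in> T \<Longrightarrow>
    H (r, x) (a, u) (b, v) = a * b + exp (2 * r) * G x u v"
begin

lemma dH:
  assumes x: "x \<in> T"
  shows "dir_deriv (\<lambda>p. H p (a, u) (b, v)) (r, x) (c, z)
    = exp (2 * r) * (2 * c * G x u v + dG x z u v)"
proof -
  have "((\<lambda>p. G (snd p) u v) has_derivative (\<lambda>h. dG x (snd h) u v)) (at (r, x))"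
    using has_derivative_compose[OF has_derivative_snd[OF has_derivative_ident] has_derivative_G, of "(r, x)"] x
    by simp
  then have "((\<lambda>p. a * b + exp (2 * fst p) * G (snd p) u v) has_derivative
      (\<lambda>h. exp (2 * r) * (2 * fst h * G x u v + dG x (snd h) u v))) (at (r, x))"
    by (auto intro!: derivative_eq_intros simp: algebra_simps)
  then have "((\<lambda>p. H p (a, u) (b, v)) has_derivative
      (\<lambda>h. exp (2 * r) * (2 * fst h * G x u v + dG x (snd h) u v))) (at (r, x))"
    by (rule has_derivative_transform_within_open[OF _ open_Times[OF open_UNIV open_T]])
       (use x in \<open>auto simp: warped\<close>)
  from fun_cong[OF frechet_derivative_at[OF this, symmetric], of "(c, z)"] show ?thesis by simp
qed

text \<open>The term \<open>\<Gamma> x u v\<close> comes from the factor \<open>N\<close>; the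
  others come from the r-derivative of \<open>exp (2 * r)\<close>. The candidate is checked against
  the Koszul formula for \<open>H\<close>.\<close>

lemma christoffel_warped:
  assumes x: "x \<in> T"
  shows "christoffel H (r, x) (a, u) (b, v)
    = (- exp (2 * r) * G x u v, \<Gamma> x u v + a *\<^sub>R v + b *\<^sub>R u)"
  unfolding christoffel_def[of H]
proof (rule the_equality)
  let ?w = "(- exp (2 * r) * G x u v, \<Gamma> x u v + a *\<^sub>R v + b *\<^sub>R u)"
  let ?K = "\<lambda>z. dir_deriv (\<lambda>y. H y (b, v) z) (r, x) (a, u)
       + dir_deriv (\<lambda>y. H y (a, u) z) (r, x) (b, v) - dir_deriv (\<lambda>y. H y (a, u) (b, v)) (r, x) z"
  have K: "?K z = 2 * H (r, x) ?w z" for z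
  proof -
    obtain c y where z: "z = (c, y)" by (cases z)
    have "exp (2 * r) * (2 * G x (\<Gamma> x u v) y) = exp (2 * r) * (dG x u v y + dG x v u y - dG x y u v)"
      using koszul[OF x] by simp
    then show ?thesis
      by (simp add: z dH warped x G_bilinear_simps algebra_simps)
  qed
  then show "\<forall>z. 2 * H (r, x) ?w z = ?K z" by simp
  fix w assume w: "\<forall>z. 2 * H (r, x) w z = ?K z"
  obtain k y where wk: "w = (k, y)" by (cases w)
  \<comment> \<open>Uniqueness: testing against (1, 0) isolates the radial component, testing
    against (0, z) the component in \<open>N\<close>, where \<open>G\<close> is
    nondegenerate.\<close>
  have eq: "H (r, x) (k, y) z = H (r, x) ?w z" for z using w K[of z] wk by (metis mult_cancel_left zero_neq_numeral)
  have "k = - exp (2 * r) * G x u v"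
    using eq[of "(1, 0)"] by (simp add: warped x G_bilinear_simps)
  moreover have "y = \<Gamma> x u v + a *\<^sub>R v + b *\<^sub>R u"
    using eq[of "(0, z)" for z] by (intro G_eqI[OF x]) (simp add: warped x)
  ultimately show "w = ?w" using wk by simp
qed

lemma dchristoffel_warped:
  assumes x: "x \<in> T"
  shows "dir_deriv (\<lambda>p. christoffel H p (a, u) (b, v)) (r, x) (c, z)
    = (- exp (2 * r) * (2 * c * G x u v + dG x z u v), dir_deriv (\<lambda>y. \<Gamma> y u v) x z)"
proof -
  have "((\<lambda>p. G (snd p) u v) has_derivative (\<lambda>h. dG x (snd h) u v)) (at (r, x))"
    using has_derivative_compose[OF has_derivative_snd[OF has_derivative_ident] has_derivative_G, of "(r, x)"] x
    by simp
  moreover have "((\<lambda>p. \<Gamma> (snd p) u v) has_derivative (\<lambda>h. dir_deriv (\<lambda>y. \<Gamma> y u v) x (snd h))) (at (r, x))"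
    using has_derivative_compose[OF has_derivative_snd[OF has_derivative_ident] has_derivative_christoffel, of "(r, x)"] x
    by simp
  ultimately have "((\<lambda>p. (- exp (2 * fst p) * G (snd p) u v, \<Gamma> (snd p) u v + a *\<^sub>R v + b *\<^sub>R u)) has_derivative
      (\<lambda>h. (- exp (2 * r) * (2 * fst h * G x u v + dG x (snd h) u v), dir_deriv (\<lambda>y. \<Gamma> y u v) x (snd h))))
      (at (r, x))"
    by (auto intro!: derivative_eq_intros simp: algebra_simps)
  then have "((\<lambda>p. christoffel H p (a, u) (b, v)) has_derivative
      (\<lambda>h. (- exp (2 * r) * (2 * fst h * G x u v + dG x (snd h) u v), dir_deriv (\<lambda>y. \<Gamma> y u v) x (snd h))))
      (at (r, x))"
    by (rule has_derivative_transform_within_open[OF _ open_Times[OF open_UNIV open_T]])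
       (use x in \<open>auto simp: christoffel_warped\<close>)
  from fun_cong[OF frechet_derivative_at[OF this, symmetric], of "(c, z)"] show ?thesis by simp
qed

text \<open>With U = (a, u), V = (b, v) and inner products taken in \<open>H\<close>, the right side
  is (0, R(u,v)v) minus |V|^2 U - <U,V> V, where R is the curvature of \<open>G\<close>.\<close>

lemma curvature_warped:
  assumes x: "x \<in> T"
  shows "curvature H (r, x) (a, u) (b, v) (b, v)
    = (exp (2 * r) * (b * G x u v - a * G x v v),
       curvature G x u v v + (a * b) *\<^sub>R v - b\<^sup>2 *\<^sub>R u
         - exp (2 * r) *\<^sub>R (G x v v *\<^sub>R u - G x u v *\<^sub>R v))"
proof -
  note lin = linear_add[OF linear_christoffel[OF x]] linear_cmul[OF linear_christoffel[OF x]]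
  \<comment> \<open>The radial Christoffel component contains \<open>G\<close>, so derivatives of
    \<open>G\<close> enter the curvature. Metric compatibility turns them into Christoffel terms
    that cancel.\<close>
  have dv: "dG x v u v = G x (\<Gamma> x u v) v + G x u (\<Gamma> x v v)"
    using metric_compatible[OF x, of u v v] christoffel_sym[OF x, of v u] by simp
  have du: "dG x u v v = 2 * G x v (\<Gamma> x u v)"
    using metric_compatible[OF x, of v v u] sym_G[OF x, of "\<Gamma> x u v" v] by simp
  show ?thesis
    by (simp add: curvature_def[of H] curvature_def[of G] dchristoffel_warped christoffel_warped x
        lin du dv christoffel_sym[OF x, of v u] sym_G[OF x, of "\<Gamma> x u v" v] sym_G[OF x, of v u]
        G_bilinear_simps algebra_simps scaleR_2 power2_eq_square flip: scaleR_add_left)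
qed

text \<open>Paired with U, the constant curvature part of \<open>curvature_warped\<close> is minus
  the Gram determinant, that is -1 under \<open>area\<close>.\<close>

lemma coord_sec_warped:
  assumes x: "x \<in> T"
    and area: "H (r, x) (a, u) (a, u) * H (r, x) (b, v) (b, v) - (H (r, x) (a, u) (b, v))\<^sup>2 = 1"
  shows "coord_sec H (r, x) (a, u) (b, v) = exp (2 * r) * G x (curvature G x u v v) u - 1"
  unfolding coord_sec_def area curvature_warped[OF x]
  using area sym_G[OF x, of v u]
  by (simp add: warped x G_bilinear_simps algebra_simps power2_eq_square)

text \<open>Stated for any radial \<open>F\<close> because it is applied twice: to the density in
  coordinates and to its directional derivative, which is radial again.\<close>

lemma radial_derivative:
  assumes F: "\<And>r x. x \<in> T \<Longrightarrow> F (r, x) = h r" and h: "(h has_real_derivative h') (at r)" and x: "x \<in> T"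
  shows "(F has_derivative (\<lambda>V. h' * fst V)) (at (r, x))"
proof -
  have "((\<lambda>p. h (fst p)) has_derivative (\<lambda>V. h' * fst V)) (at (r, x))"
    using h by (intro has_derivative_compose[OF has_derivative_fst[OF has_derivative_ident]])
      (simp add: has_field_derivative_def)
  then show ?thesis
    by (rule has_derivative_transform_within_open[OF _ open_Times[OF open_UNIV open_T]])
       (use x in \<open>auto simp: F\<close>)
qed

text \<open>dF sees only the radial Christoffel component \<open>- exp (2 * r) * G x v v\<close>,
  whence the plus sign. For a unit vector, \<open>exp (2 * r) * G x v v\<close> is 1 - b^2.\<close>

lemma coord_hess_warped:
  assumes F: "\<And>r x. x \<in> T \<Longrightarrow> F (r, x) = h r"
    and h: "\<And>r. (h has_real_derivative h' r) (at r)" "\<And>r. (h' has_real_derivative h'' r) (at r)"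
    and x: "x \<in> T"
  shows "coord_hess H F (r, x) (b, v) (b, v) = h'' r * b\<^sup>2 + h' r * exp (2 * r) * G x v v"
proof -
  have dF: "dir_deriv F (r, x) (c, z) = h' r * c" if "x \<in> T" for r x c z
    using fun_cong[OF frechet_derivative_at[OF radial_derivative[OF F h(1)[of r] that], symmetric], of "(c, z)"]
    by simp
  have "((\<lambda>r. h' r * b) has_real_derivative h'' r * b) (at r)"
    by (rule DERIV_cmult_right[OF h(2)])
  from frechet_derivative_at[OF radial_derivative[where F = "\<lambda>p. dir_deriv F p (b, v)", OF dF this x], symmetric]
  have "dir_deriv (\<lambda>p. dir_deriv F p (b, v)) (r, x) (b, v) = h'' r * b * b" by simp
  then show ?thesis
    by (simp add: coord_hess_def christoffel_warped dF x power2_eq_square)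
qed

end

section \<open>Charts\<close>

lemma chart_inv_chart: "is_chart c \<Longrightarrow> p \<in> fst c \<Longrightarrow> chart_inv c (snd c p) = p"
  by (auto simp: is_chart_def homeomorphism_def)

lemma chart_chart_inv:
  assumes "is_chart c" "x \<in> snd c ` fst c"
  shows "snd c (chart_inv c x) = x" "chart_inv c x \<in> fst c"
  using assms by (auto simp: chart_inv_chart)

lemma chart_inv_neighbourhood:
  assumes c: "is_chart c" and p: "p \<in> fst c" and U: "open U" "p \<in> U"
  obtains S where "open S" "snd c p \<in> S" "S \<subseteq> snd c ` fst c" "\<And>x. x \<in> S \<Longrightarrow> chart_inv c x \<in> U"
proof
  have "continuous_on (snd c ` fst c) (chart_inv c)" "open (snd c ` fst c)"
    using c by (auto simp: is_chart_def homeomorphism_def)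
  then show "open (chart_inv c -` U \<inter> snd c ` fst c)"
    using U(1) by (metis continuous_on_open_vimage)
qed (use p U chart_inv_chart[OF c p] in auto)

text \<open>The chain rule through the transition map. The factorization is valid only where
  \<open>chart_inv c\<close> lands in the domain of \<open>d\<close>, hence the neighbourhood
  \<open>S\<close>.\<close>

lemma has_derivative_change_chart:
  assumes c: "is_chart c" and d: "is_chart d" and p: "p \<in> fst c" "p \<in> fst d"
    and \<tau>: "((snd d \<circ> chart_inv c) has_derivative D) (at (snd c p))"
    and f: "((f \<circ> chart_inv d) has_derivative E) (at (snd d p))"
  shows "((f \<circ> chart_inv c) has_derivative (\<lambda>u. E (D u))) (at (snd c p))"
proof -
  obtain S where S: "open S" "snd c p \<in> S" "\<And>x. x \<in> S \<Longrightarrow> chart_inv c x \<in> fst d"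
    using chart_inv_neighbourhood[OF c p(1) _ p(2)] d by (metis is_chart_def)
  have "((f \<circ> chart_inv d) has_derivative E) (at ((snd d \<circ> chart_inv c) (snd c p)))"
    using f by (simp add: chart_inv_chart[OF c p(1)])
  then have "((\<lambda>x. (f \<circ> chart_inv d) ((snd d \<circ> chart_inv c) x)) has_derivative (\<lambda>u. E (D u))) (at (snd c p))"
    by (rule has_derivative_compose[OF \<tau>])
  then show ?thesis
    by (rule has_derivative_transform_within_open[OF _ S(1,2)]) (simp add: chart_inv_chart[OF d] S(3))
qed

lemma coord_vec_eq:
  assumes "((f \<circ> chart_inv c) has_derivative D) (at (snd c p))"
  shows "coord_vec c p u f = D u"
  using assms frechet_derivative_at[OF assms] by (auto simp: coord_vec_def differentiable_def)

text \<open>One transition map gives equality on functions differentiable at \<open>p\<close>. The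
  other serves the default value 0: a function not differentiable in chart \<open>d\<close> is not
  differentiable in chart \<open>c\<close>.\<close>

lemma coord_vec_change:
  assumes c: "is_chart c" and d: "is_chart d" and p: "p \<in> fst c" "p \<in> fst d"
    and "(snd d \<circ> chart_inv c) differentiable (at (snd c p))"
    and "(snd c \<circ> chart_inv d) differentiable (at (snd d p))"
  shows "\<exists>w. coord_vec c p u = coord_vec d p w"
proof -
  obtain D D' where D: "((snd d \<circ> chart_inv c) has_derivative D) (at (snd c p))"
    and D': "((snd c \<circ> chart_inv d) has_derivative D') (at (snd d p))"
    using assms(5,6) by (auto simp: differentiable_def)
  have "coord_vec c p u f = coord_vec d p (D u) f" for f
  proof (cases "(f \<circ> chart_inv d) differentiable (at (snd d p))")
    case True
    then obtain E where E: "((f \<circ> chart_inv d) has_derivative E) (at (snd d p))"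
      by (auto simp: differentiable_def)
    show ?thesis
      using coord_vec_eq[OF has_derivative_change_chart[OF c d p D E]] coord_vec_eq[OF E] by simp
  next
    case False
    then have "\<not> (f \<circ> chart_inv c) differentiable (at (snd c p))"
      using has_derivative_change_chart[OF d c p(2,1) D'] by (auto simp: differentiable_def)
    then show ?thesis using False by (simp add: coord_vec_def)
  qed
  then show ?thesis by blast
qed

text \<open>The coordinate functions are linear in the chart. Recovering \<open>u\<close> lets
  nonvanishing and independence pass from coordinate vectors to tangent vectors.\<close>

lemma components_coord_vec:
  assumes c: "is_chart c" and p: "p \<in> fst c"
  shows "components c (coord_vec c p u) = u"
proof -
  have "coord_vec c p u (\<lambda>q. snd c q \<bullet> b) = u \<bullet> b" for b
  proof (rule coord_vec_eq)
    have "((\<lambda>x. x \<bullet> b) has_derivative (\<lambda>u. u \<bullet> b)) (at (snd c p))"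
      by (rule bounded_linear_imp_has_derivative[OF bounded_linear_inner_left])
    then show "(((\<lambda>q. snd c q \<bullet> b) \<circ> chart_inv c) has_derivative (\<lambda>u. u \<bullet> b)) (at (snd c p))"
      by (rule has_derivative_transform_within_open[where s = "snd c ` fst c"])
         (use c p chart_chart_inv[OF c] in \<open>auto simp: is_chart_def\<close>)
  qed
  then show ?thesis by (simp add: components_def euclidean_representation)
qed

lemma coord_vec_linear:
  "coord_vec c p (a *\<^sub>R u + b *\<^sub>R v) = (\<lambda>f. a * coord_vec c p u f + b * coord_vec c p v f)"
  by (rule ext) (simp add: coord_vec_def linear_add[OF linear_frechet_derivative]
      linear_cmul[OF linear_frechet_derivative])

lemma coord_vec_in_tangent_space: "c \<in> A \<Longrightarrow> p \<in> fst c \<Longrightarrow> coord_vec c p u \<in> tangent_space A p"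
  unfolding tangent_space_def by blast

lemma smooth_atlas_chart: "smooth_atlas A \<Longrightarrow> c \<in> A \<Longrightarrow> is_chart c"
  by (simp add: smooth_atlas_def)

lemma smooth_atlas_point:
  assumes "smooth_atlas A"
  obtains c q where "c \<in> A" "q \<in> fst c"
  using assms unfolding smooth_atlas_def by (metis UN_iff UNIV_I)

lemma smooth_atlas_transition:
  assumes "smooth_atlas A" "c \<in> A" "d \<in> A" "p \<in> fst c" "p \<in> fst d"
  shows "(snd d \<circ> chart_inv c) differentiable (at (snd c p))"
proof -
  have "smooth_on (snd c ` (fst c \<inter> fst d)) (snd d \<circ> chart_inv c)"
    using assms by (simp add: smooth_atlas_def)
  then show ?thesis by (rule smooth_on_differentiable) (use assms in auto)
qed

lemma local_metric_coord_metric: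
  fixes A :: "('a::{t2_space,second_countable_topology}, 'b::euclidean_space) chart set"
  assumes A: "riemannian_manifold A g" and c: "c \<in> A"
  shows "local_metric (snd c ` fst c) (coord_metric c g)"
proof -
  have chart: "is_chart c" and smooth: "smooth_on (snd c ` fst c) (\<lambda>x. coord_metric c g x u v)" for u v
    using A c by (auto simp: riemannian_manifold_def riemannian_metric_def smooth_atlas_def)
  have T: "coord_vec c p u \<in> tangent_space A p" if "p \<in> fst c" for p u
    using c that by (rule coord_vec_in_tangent_space)
  have g: "g p X Y = g p Y X"
    "Z \<in> tangent_space A p \<Longrightarrow> g p (\<lambda>f. a * X f + b * Y f) Z = a * g p X Z + b * g p Y Z"
    "X \<noteq> (\<lambda>_. 0) \<Longrightarrow> g p X X > 0"
    if "X \<in> tangent_space A p" "Y \<in> tangent_space A p" for p X Y Z a b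
    using A that unfolding riemannian_manifold_def riemannian_metric_def by blast+
  show ?thesis
  proof
    show "open (snd c ` fst c)" using chart by (simp add: is_chart_def)
    show "smooth_on (snd c ` fst c) (\<lambda>x. coord_metric c g x u v)" for u v by (rule smooth)
    fix x assume "x \<in> snd c ` fst c"
    then have x: "chart_inv c x \<in> fst c" by (rule chart_chart_inv(2)[OF chart])
    show sym: "coord_metric c g x u v = coord_metric c g x v u" for u v
      unfolding coord_metric_def by (rule g(1)[OF T[OF x] T[OF x]])
    have lin: "coord_metric c g x (a *\<^sub>R u + b *\<^sub>R v) w
        = a * coord_metric c g x u w + b * coord_metric c g x v w" for a b u v w
      unfolding coord_metric_def coord_vec_linear by (rule g(2)[OF T[OF x] T[OF x] T[OF x]])
    have "linear (\<lambda>u. coord_metric c g x u v)" for v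
      using lin[of 1 _ 1 _ v] lin[of _ _ 0 0 v] by (intro linearI) simp_all
    moreover from this have "linear (\<lambda>v. coord_metric c g x u v)" for u
      by (subst sym)
    ultimately show "bilinear (coord_metric c g x)" by (simp add: bilinear_def)
    fix u :: 'b assume "u \<noteq> 0"
    moreover have "components c (\<lambda>_. 0) = 0" by (simp add: components_def)
    ultimately have "coord_vec c (chart_inv c x) u \<noteq> (\<lambda>_. 0)"
      using components_coord_vec[OF chart x, of u] by auto
    then show "coord_metric c g x u u > 0"
      unfolding coord_metric_def by (rule g(3)[OF T[OF x] T[OF x]])
  qed
qed

section \<open>Charts and tangent vectors of the product R x N\<close>

abbreviation cyl_chart :: "('a, 'b::euclidean_space) chart \<Rightarrow> (real \<times> 'a, real \<times> 'b) chart"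
  where "cyl_chart c \<equiv> prod_chart (UNIV, \<lambda>r. r) c"

lemma cyl_atlas: "prod_atlas line_atlas A = cyl_chart ` A"
  by (auto simp: prod_atlas_def line_atlas_def)

lemma fst_cyl_chart [simp]: "fst (cyl_chart c) = UNIV \<times> fst c"
  and snd_cyl_chart [simp]: "snd (cyl_chart c) (r, q) = (r, snd c q)"
  and image_cyl_chart: "snd (cyl_chart c) ` (UNIV \<times> fst c) = UNIV \<times> snd c ` fst c"
  by (auto simp: prod_chart_def image_iff)

lemma chart_inv_cyl_chart:
  assumes c: "is_chart c" and x: "x \<in> snd c ` fst c"
  shows "chart_inv (cyl_chart c) (r, x) = (r, chart_inv c x)"
proof -
  have "inj_on (snd (cyl_chart c)) (UNIV \<times> fst c)"
    by (rule inj_onI) (auto, metis c chart_inv_chart)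
  then show ?thesis
    unfolding chart_inv_def[of "cyl_chart c"] fst_cyl_chart
    by (rule inv_into_f_eq) (use chart_chart_inv[OF c x] in auto)
qed

lemma is_chart_cyl_chart:
  assumes c: "is_chart c"
  shows "is_chart (cyl_chart c)"
proof -
  have cont: "continuous_on (fst c) (snd c)" "continuous_on (snd c ` fst c) (chart_inv c)"
    and op: "open (fst c)" "open (snd c ` fst c)"
    using c by (auto simp: is_chart_def homeomorphism_def)
  have "continuous_on (UNIV \<times> fst c) (\<lambda>p. (fst p, snd c (snd p)))"
    by (auto intro!: continuous_intros continuous_on_compose2[OF cont(1)])
  then have 1: "continuous_on (UNIV \<times> fst c) (snd (cyl_chart c))"
    by (rule continuous_on_eq) auto
  have "continuous_on (UNIV \<times> snd c ` fst c) (\<lambda>p. (fst p, chart_inv c (snd p)))"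
    by (auto intro!: continuous_intros continuous_on_compose2[OF cont(2)])
  then have 2: "continuous_on (UNIV \<times> snd c ` fst c) (chart_inv (cyl_chart c))"
    by (rule continuous_on_eq) (auto simp: chart_inv_cyl_chart[OF c])
  have inv: "chart_inv (cyl_chart c) (r, snd c q) = (r, q)" if "q \<in> fst c" for r q
    using that by (simp add: chart_inv_cyl_chart[OF c] chart_inv_chart[OF c])
  have "chart_inv (cyl_chart c) ` snd (cyl_chart c) ` (UNIV \<times> fst c) = UNIV \<times> fst c"
    by (force simp: inv image_image)
  then show ?thesis
    unfolding is_chart_def homeomorphism_def fst_cyl_chart
    using 1 2 op by (auto simp: image_cyl_chart inv open_Times)
qed

lemma differentiable_cyl_transition:
  assumes c: "is_chart c" and p: "q \<in> fst c"
    and d: "(snd d \<circ> chart_inv c) differentiable (at (snd c q))"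
  shows "(snd (cyl_chart d) \<circ> chart_inv (cyl_chart c)) differentiable (at (snd (cyl_chart c) (r, q)))"
proof -
  obtain D where "((snd d \<circ> chart_inv c) has_derivative D) (at (snd c q))"
    using d by (auto simp: differentiable_def)
  then have "((\<lambda>p. (snd d \<circ> chart_inv c) (snd p)) has_derivative (\<lambda>h. D (snd h))) (at (r, snd c q))"
    by (intro has_derivative_compose[OF has_derivative_snd[OF has_derivative_ident]]) (simp add: o_def)
  then have "((\<lambda>p. (fst p, (snd d \<circ> chart_inv c) (snd p))) has_derivative (\<lambda>h. (fst h, D (snd h))))
      (at (r, snd c q))"
    by (intro has_derivative_Pair has_derivative_fst has_derivative_ident)
  then have "((snd (cyl_chart d) \<circ> chart_inv (cyl_chart c)) has_derivative (\<lambda>h. (fst h, D (snd h))))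
      (at (r, snd c q))"
    by (rule has_derivative_transform_within_open[where s = "UNIV \<times> snd c ` fst c"])
       (use c p in \<open>auto simp: is_chart_def chart_inv_cyl_chart[OF c] intro!: open_Times\<close>)
  then show ?thesis by (auto simp: differentiable_def)
qed

text \<open>Tangent vectors may be given in any chart around the point; this brings both vectors of
  a pair into the one chart where the curvature is computed.\<close>

lemma cyl_tangent_space:
  assumes A: "smooth_atlas A" and d: "d \<in> A" "q \<in> fst d"
    and X: "X \<in> tangent_space (prod_atlas line_atlas A) (r, q)"
  obtains a u where "X = coord_vec (cyl_chart d) (r, q) (a, u)"
proof -
  obtain c w where c: "c \<in> A" "q \<in> fst c" and w: "X = coord_vec (cyl_chart c) (r, q) w"
  proof -
    obtain e w where "e \<in> cyl_chart ` A" "(r, q) \<in> fst e" "X = coord_vec e (r, q) w"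
      using X unfolding tangent_space_def cyl_atlas by blast
    then obtain c where "c \<in> A" "(r, q) \<in> fst (cyl_chart c)" "X = coord_vec (cyl_chart c) (r, q) w"
      by blast
    then show ?thesis using that[of c w] by simp
  qed
  note ch = smooth_atlas_chart[OF A]
  have "\<exists>w'. X = coord_vec (cyl_chart d) (r, q) w'"
    unfolding w using c d
    by (intro coord_vec_change is_chart_cyl_chart ch differentiable_cyl_transition
        smooth_atlas_transition[OF A]) auto
  then show thesis using that by (metis surj_pair)
qed

text \<open>Used with \<open>h\<close> the identity for dr, which enters the metric, and with
  \<open>h r = k * r\<close> for df(V).\<close>

lemma coord_vec_cyl_fst:
  assumes c: "is_chart c" and q: "q \<in> fst c" and h: "(h has_real_derivative h') (at r)"
    and f: "\<And>s q. f (s, q) = h s"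
  shows "coord_vec (cyl_chart c) (r, q) (a, u) f = h' * a"
proof -
  have "((\<lambda>p. h (fst p)) has_derivative (\<lambda>V. h' * fst V)) (at (r, snd c q))"
    using h by (intro has_derivative_compose[OF has_derivative_fst[OF has_derivative_ident]])
      (simp add: has_field_derivative_def)
  then have "((f \<circ> chart_inv (cyl_chart c)) has_derivative (\<lambda>V. h' * fst V)) (at (r, snd c q))"
    by (rule has_derivative_transform_within_open[where s = "UNIV \<times> snd c ` fst c"])
       (use c q in \<open>auto simp: is_chart_def chart_inv_cyl_chart[OF c] f intro!: open_Times\<close>)
  then show ?thesis using coord_vec_eq[of f "cyl_chart c" _ "(r, q)" "(a, u)"] by simp
qed

text \<open>The equality concerns all functions \<open>h\<close>, so besides the chain rule it must
  be shown that both sides take the default value 0 on the same \<open>h\<close>.\<close>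

lemma coord_vec_cyl_snd:
  assumes c: "is_chart c" and q: "q \<in> fst c"
  shows "(\<lambda>h. coord_vec (cyl_chart c) (r, q) (a, u) (h \<circ> snd)) = coord_vec c q u"
proof
  fix h :: "'a \<Rightarrow> real"
  let ?f = "h \<circ> chart_inv c"
  have S: "open (UNIV \<times> snd c ` fst c)" "(r, snd c q) \<in> UNIV \<times> snd c ` fst c"
    using c q by (auto simp: is_chart_def intro: open_Times)
  have eq: "((h \<circ> snd) \<circ> chart_inv (cyl_chart c)) p = ?f (snd p)" if "p \<in> UNIV \<times> snd c ` fst c" for p
    using that by (auto simp: chart_inv_cyl_chart[OF c])
  show "coord_vec (cyl_chart c) (r, q) (a, u) (h \<circ> snd) = coord_vec c q u h"
  proof (cases "?f differentiable (at (snd c q))")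
    case True
    then obtain D where D: "(?f has_derivative D) (at (snd c q))" by (auto simp: differentiable_def)
    then have "((\<lambda>p. ?f (snd p)) has_derivative (\<lambda>V. D (snd V))) (at (r, snd c q))"
      by (intro has_derivative_compose[OF has_derivative_snd[OF has_derivative_ident]]) (simp add: o_def)
    then have "(((h \<circ> snd) \<circ> chart_inv (cyl_chart c)) has_derivative (\<lambda>V. D (snd V))) (at (r, snd c q))"
      by (rule has_derivative_transform_within_open[OF _ S]) (simp only: eq)
    then show ?thesis
      using coord_vec_eq[of "h \<circ> snd" "cyl_chart c" _ "(r, q)" "(a, u)"] coord_vec_eq[OF D, of u] by simp
  next
    case False
    have "\<not> ((h \<circ> snd) \<circ> chart_inv (cyl_chart c)) differentiable (at (r, snd c q))"
    proof
      assume "((h \<circ> snd) \<circ> chart_inv (cyl_chart c)) differentiable (at (r, snd c q))"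
      then have "(\<lambda>p. ?f (snd p)) differentiable (at (r, snd c q))"
        using frechet_derivative_transform_open(2)[OF S eq] by simp
      \<comment> \<open>Restriction to the slice {r} x N: differentiability of
        \<open>h \<circ> snd\<close> would be inherited by \<open>h\<close>.\<close>
      moreover have "(\<lambda>x. (r, x)) differentiable (at (snd c q))"
        using has_derivative_Pair[OF has_derivative_const has_derivative_ident]
        by (auto simp: differentiable_def)
      ultimately have "(\<lambda>x. ?f (snd (r, x))) differentiable (at (snd c q))"
        by (rule differentiable_compose)
      then show False using False by (simp add: o_def)
    qed
    then show ?thesis using False by (simp add: coord_vec_def)
  qed
qed

section \<open>The warped metric in product charts, its sectional curvature and Hessians\<close>

lemma warped_metric_coord_vec:
  assumes c: "is_chart c" and q: "q \<in> fst c"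
  shows "warped_metric gN (r, q) (coord_vec (cyl_chart c) (r, q) (a, u)) (coord_vec (cyl_chart c) (r, q) (b, v))
    = a * b + exp (2 * r) * coord_metric c gN (snd c q) u v"
  using coord_vec_cyl_fst[OF c q, of "\<lambda>x. x" 1 r fst]
  by (simp add: warped_metric_def coord_vec_cyl_snd[OF c q] coord_metric_def chart_inv_chart[OF c q])

lemma warped_local_metric_cyl_chart:
  fixes A :: "('a::{t2_space,second_countable_topology}, 'b::euclidean_space) chart set"
  assumes A: "riemannian_manifold A gN" and c: "c \<in> A"
  shows "warped_local_metric (snd c ` fst c) (coord_metric c gN)
    (coord_metric (cyl_chart c) (warped_metric gN))"
proof -
  have ch: "is_chart c" using A c by (auto simp: riemannian_manifold_def smooth_atlas_def)
  interpret local_metric "snd c ` fst c" "coord_metric c gN"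
    by (rule local_metric_coord_metric[OF A c])
  show ?thesis
  proof
    fix r a b :: real and x u v assume x: "x \<in> snd c ` fst c"
    note x' = chart_chart_inv[OF ch x]
    show "coord_metric (cyl_chart c) (warped_metric gN) (r, x) (a, u) (b, v)
      = a * b + exp (2 * r) * coord_metric c gN x u v"
      using warped_metric_coord_vec[OF ch x'(2), of gN r a u b v]
      by (simp add: coord_metric_def[of "cyl_chart c"] chart_inv_cyl_chart[OF ch x] x'(1))
  qed
qed

text \<open>An orthonormal pair on R x N may project to dependent vectors on \<open>N\<close>, where
  \<open>nonneg_sec\<close> says nothing. There the numerator of the sectional curvature vanishes;
  otherwise it is the curvature times a positive Gram determinant.\<close>

lemma curvature_form_nonneg:
  fixes A :: "('a::{t2_space,second_countable_topology}, 'b::euclidean_space) chart set"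
  assumes A: "riemannian_manifold A gN" "nonneg_sec A gN" and c: "c \<in> A" and q: "q \<in> fst c"
  shows "coord_metric c gN (snd c q) (curvature (coord_metric c gN) (snd c q) u v v) u \<ge> 0"
proof -
  interpret local_metric "snd c ` fst c" "coord_metric c gN"
    by (rule local_metric_coord_metric[OF A(1) c])
  have ch: "is_chart c" using A c by (auto simp: riemannian_manifold_def smooth_atlas_def)
  have x: "snd c q \<in> snd c ` fst c" using q by simp
  consider "u = 0" | t where "v = t *\<^sub>R u" | "u \<noteq> 0" "\<And>t. v \<noteq> t *\<^sub>R u" by blast
  then show ?thesis
  proof cases
    case 3
    have "lin_indep (coord_vec c q u) (coord_vec c q v)"
      unfolding lin_indep_def
    proof (intro allI impI)
      fix a b
      assume "(\<lambda>f. a * coord_vec c q u f + b * coord_vec c q v f) = (\<lambda>_. 0)"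
      then have "a *\<^sub>R u + b *\<^sub>R v = 0"
        using components_coord_vec[OF ch q, of "a *\<^sub>R u + b *\<^sub>R v"]
        by (simp add: coord_vec_linear components_def)
      moreover have "b = 0"
      proof (rule ccontr)
        assume "b \<noteq> 0"
        then have "v = (1 / b) *\<^sub>R (b *\<^sub>R v)" by simp
        also have "b *\<^sub>R v = - a *\<^sub>R u"
          using \<open>a *\<^sub>R u + b *\<^sub>R v = 0\<close> by (simp add: add_eq_0_iff)
        finally have "v = (1 / b * - a) *\<^sub>R u" by (simp only: scaleR_scaleR)
        then show False using 3(2) by blast
      qed
      ultimately show "a = 0 \<and> b = 0" using 3(1) by simp
    qed
    then have "sec c gN q (coord_vec c q u) (coord_vec c q v) \<ge> 0"
      using A(2) c q coord_vec_in_tangent_space[OF c q] unfolding nonneg_sec_def by blast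
    then show ?thesis
      using gram_pos[OF x 3(2,1)]
      by (simp add: sec_def components_coord_vec[OF ch q] coord_sec_def zero_le_divide_iff)
  qed (simp_all add: curvature_parallel G_bilinear_simps x)
qed

lemma sec_warped_metric:
  fixes A :: "('a::{t2_space,second_countable_topology}, 'b::euclidean_space) chart set"
  assumes A: "riemannian_manifold A gN" and c: "c \<in> A" and q: "q \<in> fst c"
    and "U = coord_vec (cyl_chart c) (r, q) (a, u)" "V = coord_vec (cyl_chart c) (r, q) (b, v)"
    and on: "orthonormal_pair (warped_metric gN) (r, q) U V"
  shows "sec (cyl_chart c) (warped_metric gN) (r, q) U V = exp (2 * r) *
    coord_metric c gN (snd c q) (curvature (coord_metric c gN) (snd c q) u v v) u - 1"
proof -
  interpret warped_local_metric "snd c ` fst c" "coord_metric c gN"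
    "coord_metric (cyl_chart c) (warped_metric gN)"
    by (rule warped_local_metric_cyl_chart[OF A c])
  have ch: "is_chart c" using A c by (auto simp: riemannian_manifold_def smooth_atlas_def)
  have x: "snd c q \<in> snd c ` fst c" using q by simp
  show ?thesis
    using on coord_sec_warped[OF x, of r a u b v]
    by (simp add: assms(4,5) orthonormal_pair_def warped_metric_coord_vec[OF ch q] sec_def warped[OF x]
        components_coord_vec[OF is_chart_cyl_chart[OF ch]] q)
qed

lemma hess_warped_metric:
  fixes A :: "('a::{t2_space,second_countable_topology}, 'b::euclidean_space) chart set"
  assumes A: "riemannian_manifold A gN" and c: "c \<in> A" and q: "q \<in> fst c"
    and "V = coord_vec (cyl_chart c) (r, q) (b, v)"
    and f: "\<And>r q. f (r, q) = h r"
    and h: "\<And>r. (h has_real_derivative h' r) (at r)" "\<And>r. (h' has_real_derivative h'' r) (at r)"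
  shows "hess (cyl_chart c) (warped_metric gN) f (r, q) V V
    = h'' r * b\<^sup>2 + h' r * exp (2 * r) * coord_metric c gN (snd c q) v v"
proof -
  interpret warped_local_metric "snd c ` fst c" "coord_metric c gN"
    "coord_metric (cyl_chart c) (warped_metric gN)"
    by (rule warped_local_metric_cyl_chart[OF A c])
  have ch: "is_chart c" using A c by (auto simp: riemannian_manifold_def smooth_atlas_def)
  have x: "snd c q \<in> snd c ` fst c" using q by simp
  have "(f \<circ> chart_inv (cyl_chart c)) (r, x) = h r" if "x \<in> snd c ` fst c" for r x
    by (simp add: chart_inv_cyl_chart[OF ch that] f)
  from coord_hess_warped[OF this h x, of r b v] show ?thesis
    by (simp add: assms(4) hess_def components_coord_vec[OF is_chart_cyl_chart[OF ch]] q o_def)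
qed

section \<open>Radial densities\<close>

lemma radial_density_linear:
  assumes A: "smooth_atlas A"
  shows "radial_density A (\<lambda>p. k * fst p)"
proof -
  have "smooth_on (UNIV \<times> snd c ` fst c) ((\<lambda>p. k * fst p) \<circ> chart_inv (cyl_chart c))" if "c \<in> A" for c
  proof -
    have ch: "is_chart c" by (rule smooth_atlas_chart[OF A that])
    \<comment> \<open>A product chart leaves the radial coordinate unchanged, so on its image the
      density is still this bounded linear map.\<close>
    have "smooth_on (UNIV \<times> snd c ` fst c) (\<lambda>p. k * fst p)"
      by (intro smooth_on_bounded_linear bounded_linear_const_mult bounded_linear_fst)
    then show ?thesis
      by (rule smooth_on_cong_open[rotated 2])
         (use ch in \<open>auto simp: is_chart_def chart_inv_cyl_chart[OF ch] intro!: open_Times\<close>)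
  qed
  then show ?thesis
    by (auto simp: radial_density_def smooth_fun_def cyl_atlas image_cyl_chart)
qed

text \<open>The profile \<open>h\<close> is \<open>f\<close> along the line R x {q} for one point
  \<open>q\<close>, so it inherits smoothness from a chart around \<open>q\<close>. Restricting to
  the line is done twice: for the density and for its derivative in direction (1, 0).\<close>

lemma radial_density_derivatives:
  fixes A :: "('a::{t2_space,second_countable_topology}, 'b::euclidean_space) chart set"
  assumes A: "smooth_atlas A" and f: "radial_density A f"
  obtains h h' h'' where "\<And>r q. f (r, q) = h r" "\<And>r. (h has_real_derivative h' r) (at r)"
    "\<And>r. (h' has_real_derivative h'' r) (at r)"
proof -
  obtain h where h: "\<And>r q. f (r, q) = h r" using f by (auto simp: radial_density_def)
  obtain c q where c: "c \<in> A" "q \<in> fst c" using smooth_atlas_point[OF A] by blast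
  have ch: "is_chart c" by (rule smooth_atlas_chart[OF A c(1)])
  let ?F = "f \<circ> chart_inv (cyl_chart c)" and ?x = "snd c q"
  let ?S = "UNIV \<times> snd c ` fst c"
  have sm: "smooth_on ?S ?F"
    using f c by (auto simp: radial_density_def smooth_fun_def cyl_atlas image_cyl_chart)
  have restrict: "((\<lambda>r. K (r, ?x)) has_real_derivative frechet_derivative K (at (r, ?x)) (1, 0)) (at r)"
    if "smooth_on ?S K" for K r
  proof -
    have K: "(K has_derivative frechet_derivative K (at (r, ?x))) (at (r, ?x))"
      using smooth_on_differentiable[OF that, of "(r, ?x)"] c(2) frechet_derivative_works by blast
    have "((\<lambda>r. K (r, ?x)) has_derivative (\<lambda>s. frechet_derivative K (at (r, ?x)) (s, 0))) (at r)"
      using has_derivative_compose[OF has_derivative_Pair[OF has_derivative_ident has_derivative_const] K] .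
    moreover have "(\<lambda>s. frechet_derivative K (at (r, ?x)) (s, 0)) = (*) (frechet_derivative K (at (r, ?x)) (1, 0))"
    proof
      fix s
      show "frechet_derivative K (at (r, ?x)) (s, 0) = frechet_derivative K (at (r, ?x)) (1, 0) * s"
        using linear_cmul[OF has_derivative_linear[OF K], of s "(1, 0)"] by simp
    qed
    ultimately show ?thesis by (simp only: has_field_derivative_def)
  qed
  have "?F (r, ?x) = h r" for r using c by (simp add: chart_inv_cyl_chart[OF ch] h)
  with restrict[OF sm] have "(h has_real_derivative dir_deriv ?F (r, ?x) (1, 0)) (at r)" for r by simp
  then show thesis using that[OF h _ restrict[OF smooth_on_dir_deriv[OF sm]]] by blast
qed

theorem proposition2p8:
  fixes A :: "('a::{t2_space,second_countable_topology}, 'b::euclidean_space) chart set"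
    and gN :: "'a metric"
  assumes "riemannian_manifold A gN"
    and "nonneg_sec A gN"
  shows "(\<forall>l::real. \<exists>f. radial_density A f \<and>
             strong_weighted_sec_ge (prod_atlas line_atlas A) (warped_metric gN) f l)
       \<and> (\<forall>\<epsilon>::real. \<epsilon> > 0 \<longrightarrow> \<not> (\<exists>f. radial_density A f \<and>
             weighted_sec_ge (prod_atlas line_atlas A) (warped_metric gN) f (- 1 + \<epsilon>)))"
proof (intro conjI allI impI notI)
  have A: "smooth_atlas A" using assms(1) by (simp add: riemannian_manifold_def)
  note ch = smooth_atlas_chart[OF A]
  fix l :: real
  \<comment> \<open>\<open>k \<ge> 1\<close> makes the excess \<open>k * (k - 1) * b\<^sup>2\<close>
    below nonnegative, and \<open>k \<ge> l + 1\<close> turns the bound k - 1 into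
    \<open>l\<close>.\<close>
  define k where "k = max 1 (l + 1)"
  have k: "k \<ge> 1" "k \<ge> l + 1" by (auto simp: k_def)
  let ?f = "\<lambda>p::real \<times> 'a. k * fst p"
  have "strong_weighted_sec (cyl_chart c) (warped_metric gN) ?f (r, q) V U \<ge> l"
    if c: "c \<in> A" and q: "q \<in> fst c"
      and UV: "U \<in> tangent_space (prod_atlas line_atlas A) (r, q)" "V \<in> tangent_space (prod_atlas line_atlas A) (r, q)"
      and on: "orthonormal_pair (warped_metric gN) (r, q) U V" for c r q U V
  proof -
    obtain a u where U: "U = coord_vec (cyl_chart c) (r, q) (a, u)"
      using cyl_tangent_space[OF A c q UV(1)] .
    obtain b v where V: "V = coord_vec (cyl_chart c) (r, q) (b, v)"
      using cyl_tangent_space[OF A c q UV(2)] .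
    have unit: "b\<^sup>2 + exp (2 * r) * coord_metric c gN (snd c q) v v = 1"
      using on by (simp add: V orthonormal_pair_def warped_metric_coord_vec[OF ch[OF c] q] power2_eq_square)
    have "sec (cyl_chart c) (warped_metric gN) (r, q) U V \<ge> - 1"
      using curvature_form_nonneg[OF assms c q, of u v] sec_warped_metric[OF assms(1) c q U V on] by simp
    moreover have "hess (cyl_chart c) (warped_metric gN) ?f (r, q) V V = k * (1 - b\<^sup>2)"
    proof -
      have "hess (cyl_chart c) (warped_metric gN) ?f (r, q) V V
          = 0 * b\<^sup>2 + k * exp (2 * r) * coord_metric c gN (snd c q) v v"
        by (rule hess_warped_metric[OF assms(1) c q V, where h = "\<lambda>r. k * r"])
           (auto intro!: derivative_eq_intros)
      then show ?thesis using unit by (simp add: mult.assoc flip: unit)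
    qed
    moreover have "V ?f = k * b"
      unfolding V by (rule coord_vec_cyl_fst[OF ch[OF c] q, where h = "\<lambda>r. k * r"])
        (auto intro!: derivative_eq_intros)
    moreover have "k * (1 - b\<^sup>2) + (k * b)\<^sup>2 \<ge> k"
    proof -
      have "0 \<le> k * (k - 1) * b\<^sup>2" using k(1) by simp
      then show ?thesis by (simp add: algebra_simps power2_eq_square)
    qed
    ultimately show ?thesis
      using k(2) by (simp add: strong_weighted_sec_def weighted_sec_def)
  qed
  then have "strong_weighted_sec_ge (prod_atlas line_atlas A) (warped_metric gN) ?f l"
    by (auto simp: strong_weighted_sec_ge_def cyl_atlas)
  with radial_density_linear[OF A]
  show "\<exists>f. radial_density A f \<and> strong_weighted_sec_ge (prod_atlas line_atlas A) (warped_metric gN) f l"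
    by blast
next
  have A: "smooth_atlas A" using assms(1) by (simp add: riemannian_manifold_def)
  fix \<epsilon> :: real
  assume \<epsilon>: "\<epsilon> > 0" and "\<exists>f. radial_density A f \<and>
    weighted_sec_ge (prod_atlas line_atlas A) (warped_metric gN) f (- 1 + \<epsilon>)"
  then obtain f where f: "radial_density A f"
    and ge: "weighted_sec_ge (prod_atlas line_atlas A) (warped_metric gN) f (- 1 + \<epsilon>)" by blast
  obtain h h' h'' where fh: "\<And>r q. f (r, q) = h r"
    and h: "\<And>r. (h has_real_derivative h' r) (at r)" "\<And>r. (h' has_real_derivative h'' r) (at r)"
    using radial_density_derivatives[OF A f] by blast
  obtain c q where c: "c \<in> A" and q: "q \<in> fst c" using smooth_atlas_point[OF A] by blast
  have ch: "is_chart c" by (rule smooth_atlas_chart[OF A c])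
  interpret local_metric "snd c ` fst c" "coord_metric c gN"
    by (rule local_metric_coord_metric[OF assms(1) c])
  have x: "snd c q \<in> snd c ` fst c" using q by simp
  let ?G = "coord_metric c gN (snd c q)"
  have ge': "weighted_sec (cyl_chart c) (warped_metric gN) f (r, q) V U \<ge> - 1 + \<epsilon>"
    if "U = coord_vec (cyl_chart c) (r, q) (a, u)" "V = coord_vec (cyl_chart c) (r, q) (b, v)"
      "orthonormal_pair (warped_metric gN) (r, q) U V" for r U V a u b v
    using ge c q that coord_vec_in_tangent_space[of "cyl_chart c" "prod_atlas line_atlas A" "(r, q)"]
    unfolding weighted_sec_ge_def by (auto simp: cyl_atlas)
  have bounds: "h'' r \<ge> \<epsilon> \<and> h' r \<ge> \<epsilon>" for r
  proof -
    \<comment> \<open>A model space of dimension at least one provides a direction tangent to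
      \<open>N\<close>.\<close>
    obtain w :: 'b where "w \<in> Basis" using nonempty_Basis by blast
    then have w: "?G w w > 0" by (intro pos_G[OF x]) auto
    \<comment> \<open>Normalized in the warped metric at height \<open>r\<close>, which scales the
      square length in \<open>N\<close> by \<open>exp (2 * r)\<close>.\<close>
    define u where "u = (1 / sqrt (exp (2 * r) * ?G w w)) *\<^sub>R w"
    have u: "exp (2 * r) * ?G u u = 1"
      using w by (simp add: u_def G_bilinear_simps x real_sqrt_mult field_simps)
    let ?R = "coord_vec (cyl_chart c) (r, q) (1, 0)" and ?U = "coord_vec (cyl_chart c) (r, q) (0, u)"
    have on: "orthonormal_pair (warped_metric gN) (r, q) ?R ?U"
      "orthonormal_pair (warped_metric gN) (r, q) ?U ?R"
      by (simp_all add: orthonormal_pair_def warped_metric_coord_vec[OF ch q] u G_bilinear_simps x)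
    \<comment> \<open>\<open>?R\<close> projects to 0 in \<open>N\<close>, so the curvature term of
      \<open>N\<close> vanishes in either order. Taking \<open>?R\<close> as V bounds
      \<open>h'' r\<close>, taking \<open>?U\<close> as V bounds \<open>h' r\<close>.\<close>
    have "sec (cyl_chart c) (warped_metric gN) (r, q) ?U ?R = - 1"
      using sec_warped_metric[OF assms(1) c q refl refl on(2)] curvature_parallel[OF x, of u 0 0]
      by (simp add: G_bilinear_simps x)
    moreover have "sec (cyl_chart c) (warped_metric gN) (r, q) ?R ?U = - 1"
      using sec_warped_metric[OF assms(1) c q refl refl on(1)] by (simp add: G_bilinear_simps x)
    ultimately show ?thesis
      using ge'[OF refl refl on(1)] ge'[OF refl refl on(2)] u
        hess_warped_metric[OF assms(1) c q refl fh h, where r = r and b = 1 and v = 0]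
        hess_warped_metric[OF assms(1) c q refl fh h, where r = r and b = 0 and v = u]
      by (simp add: weighted_sec_def G_bilinear_simps x mult.assoc)
  qed
  \<comment> \<open>\<open>t\<close> is the zero of the line \<open>h' 0 + \<epsilon> * r\<close>.
    Since \<open>h' r - \<epsilon> * r\<close> is nondecreasing, \<open>h'\<close> lies below this
    line on the left of 0, so \<open>h' t \<le> 0\<close>, against the bound
    \<open>h' t \<ge> \<epsilon>\<close>.\<close>
  define t where "t = - h' 0 / \<epsilon>"
  have "t \<le> 0" using bounds[of 0] \<epsilon> by (simp add: t_def divide_nonpos_pos)
  then have "h' t - \<epsilon> * t \<le> h' 0 - \<epsilon> * 0"
  proof (rule DERIV_nonneg_imp_nondecreasing)
    fix r
    have "((\<lambda>r. h' r - \<epsilon> * r) has_real_derivative (h'' r - \<epsilon>)) (at r)"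
      by (auto intro!: derivative_eq_intros h)
    then show "\<exists>y. ((\<lambda>r. h' r - \<epsilon> * r) has_real_derivative y) (at r) \<and> 0 \<le> y"
      using bounds[of r] by (intro exI[of _ "h'' r - \<epsilon>"]) simp
  qed
  then have "h' t \<le> 0" using \<epsilon> by (simp add: t_def)
  with bounds[of t] \<epsilon> show False by simp
qed

end
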